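(* If $D$ is a provable $I$-type of system $\mathcal{F}$, then $D\in\forall^+$.
   Context: $\lambda$-terms are untyped; $(t)u$ denotes application. The set of $\lambda I$-terms is defined inductively: variables are $\lambda I$-terms; if $u,v$ are $\lambda I$-terms so is $(u)v$; if $u$ is a $\lambda I$-term and $x$ is free in $u$ then $\lambda x\,u$ is a $\lambda I$-term. System $\mathcal{F}$ (Curry style). Types are built from type variables $X,Y,\dots$ by $E\to F$ and $\forall X\,E$, and are identified up to renaming of bound variables. Typing rules: (ax) $x_1:A_1,\dots,x_n:A_n\vdash x_i:A_i$; ($\to_i$) from $\Gamma,x:A\vdash t:B$ infer $\Gamma\vdash\lambda x\,t:A\to B$; ($\to_e$) from $\Gamma\vdash u:A\to B$ and $\Gamma\vdash v:A$ infer $\Gamma\vdash (u)v:B$; ($\forall_i$) from $\Gamma\vdash t:A$ with $X$ not free in $\Gamma$ infer $\Gamma\vdash t:\forall X A$; ($\forall_e$) from $\Gamma\vdash t:\forall XA$ infer $\Gamma\vdash t:A[G/X]$ for any type $G$. Derivability is written $\Gamma\vdash_{\mathcal F}t:A$. Standing convention: only proper types are used, also inside derivations; a type is proper if for each of its subtypes $\forall X E$ the variable $X$ is free in $E$. A closed type $D$ is an $I$-type if every closed $\beta$-normal $\lambda$-term $t$ with $\vdash_{\mathcal F}t:D$ is a $\lambda I$-term. A type $D$ is provable if there is at least one closed $\beta\eta$-normal $\lambda$-term $t$ with $\vdash_{\mathcal F}t:D$. The sets of types $\forall^+$ and $\forall^-$ are defined by simultaneous induction: every type variable is in both $\forall^+$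 and $\forall^-$; if $T\in\forall^+$ and $T'\in\forall^-$ then $T'\to T\in\forall^+$ and $T\to T'\in\forall^-$; if $T\in\forall^+$ and $X$ is free in $T$ then $\forall X T\in\forall^+$. *)

theory Defs
  imports Main
begin

text \<open>
  Terms and types are represented with de Bruijn indices, so that both are identified up to
  renaming of bound variables.  In an abstraction \<open>Lam t\<close> (resp. \<open>All T\<close>) the bound variable is
  index \<open>0\<close> of the body.
\<close>

subsection \<open>Lambda-terms\<close>

datatype tm =
    Var nat
  | App tm tm
  | Lam tm

primrec free_tm :: "nat \<Rightarrow> tm \<Rightarrow> bool" where
  "free_tm k (Var i) \<longleftrightarrow> i = k"
| "free_tm k (App u v) \<longleftrightarrow> free_tm k u \<or> free_tm k v"
| "free_tm k (Lam u) \<longleftrightarrow> free_tm (Suc k) u"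

definition closed_tm :: "tm \<Rightarrow> bool" where
  "closed_tm t \<longleftrightarrow> (\<forall>k. \<not> free_tm k t)"

primrec lift_tm :: "nat \<Rightarrow> tm \<Rightarrow> tm" where
  "lift_tm k (Var i) = (if i < k then Var i else Var (Suc i))"
| "lift_tm k (App u v) = App (lift_tm k u) (lift_tm k v)"
| "lift_tm k (Lam u) = Lam (lift_tm (Suc k) u)"

text \<open>\<open>subst_tm k s t\<close> replaces index \<open>k\<close> by \<open>s\<close> in \<open>t\<close> and lowers the indices above \<open>k\<close>,
  the binder of \<open>k\<close> having been removed; likewise \<open>subst_ty\<close> below.\<close>

primrec subst_tm :: "nat \<Rightarrow> tm \<Rightarrow> tm \<Rightarrow> tm" where
  "subst_tm k s (Var i) = (if k < i then Var (i - 1) else if i = k then s else Var i)"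
| "subst_tm k s (App u v) = App (subst_tm k s u) (subst_tm k s v)"
| "subst_tm k s (Lam u) = Lam (subst_tm (Suc k) (lift_tm 0 s) u)"

inductive beta :: "tm \<Rightarrow> tm \<Rightarrow> bool" where
  beta_redex: "beta (App (Lam u) v) (subst_tm 0 v u)"
| beta_appL: "beta u u' \<Longrightarrow> beta (App u v) (App u' v)"
| beta_appR: "beta v v' \<Longrightarrow> beta (App u v) (App u v')"
| beta_lam: "beta u u' \<Longrightarrow> beta (Lam u) (Lam u')"

text \<open>In the eta-redex, lifting \<open>u\<close> expresses that the abstracted variable is not free in the
  function part.\<close>

inductive eta :: "tm \<Rightarrow> tm \<Rightarrow> bool" where
  eta_redex: "eta (Lam (App (lift_tm 0 u) (Var 0))) u"
| eta_appL: "eta u u' \<Longrightarrow> eta (App u v) (App u' v)"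
| eta_appR: "eta v v' \<Longrightarrow> eta (App u v) (App u v')"
| eta_lam: "eta u u' \<Longrightarrow> eta (Lam u) (Lam u')"

definition beta_normal :: "tm \<Rightarrow> bool" where
  "beta_normal t \<longleftrightarrow> (\<nexists>t'. beta t t')"

definition beta_eta_normal :: "tm \<Rightarrow> bool" where
  "beta_eta_normal t \<longleftrightarrow> (\<nexists>t'. beta t t' \<or> eta t t')"

inductive lambdaI :: "tm \<Rightarrow> bool" where
  lambdaI_var: "lambdaI (Var i)"
| lambdaI_app: "lambdaI u \<Longrightarrow> lambdaI v \<Longrightarrow> lambdaI (App u v)"
| lambdaI_lam: "lambdaI u \<Longrightarrow> free_tm 0 u \<Longrightarrow> lambdaI (Lam u)"

subsection \<open>Types\<close>

datatype ty =
    TVar nat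
  | Fun ty ty
  | All ty

primrec free_ty :: "nat \<Rightarrow> ty \<Rightarrow> bool" where
  "free_ty k (TVar i) \<longleftrightarrow> i = k"
| "free_ty k (Fun E F) \<longleftrightarrow> free_ty k E \<or> free_ty k F"
| "free_ty k (All E) \<longleftrightarrow> free_ty (Suc k) E"

definition closed_ty :: "ty \<Rightarrow> bool" where
  "closed_ty T \<longleftrightarrow> (\<forall>k. \<not> free_ty k T)"

primrec lift_ty :: "nat \<Rightarrow> ty \<Rightarrow> ty" where
  "lift_ty k (TVar i) = (if i < k then TVar i else TVar (Suc i))"
| "lift_ty k (Fun E F) = Fun (lift_ty k E) (lift_ty k F)"
| "lift_ty k (All E) = All (lift_ty (Suc k) E)"

primrec subst_ty :: "nat \<Rightarrow> ty \<Rightarrow> ty \<Rightarrow> ty" where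
  "subst_ty k G (TVar i) = (if k < i then TVar (i - 1) else if i = k then G else TVar i)"
| "subst_ty k G (Fun E F) = Fun (subst_ty k G E) (subst_ty k G F)"
| "subst_ty k G (All E) = All (subst_ty (Suc k) (lift_ty 0 G) E)"

primrec subtypes :: "ty \<Rightarrow> ty set" where
  "subtypes (TVar i) = {TVar i}"
| "subtypes (Fun E F) = insert (Fun E F) (subtypes E \<union> subtypes F)"
| "subtypes (All E) = insert (All E) (subtypes E)"

definition proper :: "ty \<Rightarrow> bool" where
  "proper T \<longleftrightarrow> (\<forall>E. All E \<in> subtypes T \<longrightarrow> free_ty 0 E)"

subsection \<open>System F, Curry style, restricted to proper types\<close>

text \<open>
  Term variable \<open>i\<close> has type \<open>\<Gamma> ! i\<close>.  Lifting the context in \<open>allI\<close> expresses that the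
  generalized variable is not free in it.  The properness premises ensure that
  all types occurring in a derivation are proper.
\<close>

inductive typing :: "ty list \<Rightarrow> tm \<Rightarrow> ty \<Rightarrow> bool" where
  ax: "\<forall>A \<in> set \<Gamma>. proper A \<Longrightarrow> i < length \<Gamma> \<Longrightarrow> typing \<Gamma> (Var i) (\<Gamma> ! i)"
| arrI: "typing (A # \<Gamma>) t B \<Longrightarrow> typing \<Gamma> (Lam t) (Fun A B)"
| arrE: "typing \<Gamma> u (Fun A B) \<Longrightarrow> typing \<Gamma> v A \<Longrightarrow> typing \<Gamma> (App u v) B"
| allI: "typing (map (lift_ty 0) \<Gamma>) t A \<Longrightarrow> proper (All A) \<Longrightarrow> typing \<Gamma> t (All A)"
| allE: "typing \<Gamma> t (All A) \<Longrightarrow> proper G \<Longrightarrow> typing \<Gamma> t (subst_ty 0 G A)"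

definition I_type :: "ty \<Rightarrow> bool" where
  "I_type D \<longleftrightarrow> closed_ty D \<and>
     (\<forall>t. closed_tm t \<and> beta_normal t \<and> typing [] t D \<longrightarrow> lambdaI t)"

definition provable :: "ty \<Rightarrow> bool" where
  "provable D \<longleftrightarrow> (\<exists>t. closed_tm t \<and> beta_eta_normal t \<and> typing [] t D)"

inductive_set forall_pos :: "ty set" and forall_neg :: "ty set" where
  pos_var: "TVar i \<in> forall_pos"
| neg_var: "TVar i \<in> forall_neg"
| pos_fun: "T \<in> forall_pos \<Longrightarrow> T' \<in> forall_neg \<Longrightarrow> Fun T' T \<in> forall_pos"
| neg_fun: "T \<in> forall_pos \<Longrightarrow> T' \<in> forall_neg \<Longrightarrow> Fun T T' \<in> forall_neg"
| pos_all: "T \<in> forall_pos \<Longrightarrow> free_ty 0 T \<Longrightarrow> All T \<in> forall_pos"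

end

theory Submission
  imports Defs
begin

text \<open>
  A type outside \<open>forall_pos\<close> has a quantifier \<open>All E\<close> in negative position.  In a normal proof that is
  a \<open>lambdaI\<close> term every hypothesis is used, so, after eta-expansion where necessary, some neutral
  subterm \<open>n\<close> of type \<open>All E\<close> is instantiated at a type \<open>G\<close>.  Instantiate it at \<open>Fun K G\<close> instead, where
  \<open>K = All X. X \<rightarrow> X \<rightarrow> X\<close> is inhabited by \<open>\<lambda>x y. x\<close>, and repair the types: a subterm \<open>v\<close> of type \<open>G\<close>
  handed to \<open>n\<close> becomes \<open>\<lambda>z. v\<close>, and a result \<open>f\<close> of type \<open>Fun K G\<close> becomes \<open>f (\<lambda>x y. x)\<close>.  As \<open>E\<close>
  mentions the bound variable, at least one repair happens, and both leave the \<open>lambdaI\<close> terms.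
  The repairs are pushed through the proof by recursion on its normal derivation,
  so no redex is ever created and no normalization theorem is needed.
\<close>

section \<open>Types\<close>

lemma subtypes_refl [simp]: "T \<in> subtypes T"
  by (cases T) auto

lemma proper_TVar [simp]: "proper (TVar i)"
  by (simp add: proper_def)

lemma proper_Fun [simp]: "proper (Fun A B) \<longleftrightarrow> proper A \<and> proper B"
  by (auto simp: proper_def)

lemma proper_All [simp]: "proper (All A) \<longleftrightarrow> free_ty 0 A \<and> proper A"
  by (auto simp: proper_def)

section \<open>Free variables, properness and the substitution calculus of types\<close>

lemma free_ty_lift_ty:
  "free_ty j (lift_ty k T) \<longleftrightarrow> (if j < k then free_ty j T else j \<noteq> k \<and> free_ty (j - 1) T)"
proof (induction T arbitrary: j k)
  case (All T)
  then show ?case by (cases j) auto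
qed auto

lemma free_ty_subst_ty_less:
  "j < k \<Longrightarrow> free_ty j (subst_ty k G T) \<longleftrightarrow> free_ty j T \<or> (free_ty k T \<and> free_ty j G)"
  by (induction T arbitrary: j k G) (auto simp: free_ty_lift_ty)

lemma free_ty_subst_ty_ge:
  "j \<ge> k \<Longrightarrow> free_ty j (subst_ty k G T) \<longleftrightarrow> free_ty (Suc j) T \<or> (free_ty k T \<and> free_ty j G)"
  by (induction T arbitrary: j k G) (auto simp: free_ty_lift_ty)

lemma proper_lift_ty [simp]: "proper (lift_ty k T) \<longleftrightarrow> proper T"
  by (induction T arbitrary: k) (auto simp: free_ty_lift_ty)

lemma proper_subst_ty: "proper T \<Longrightarrow> proper G \<Longrightarrow> proper (subst_ty k G T)"
  by (induction T arbitrary: k G) (auto simp: free_ty_subst_ty_less free_ty_lift_ty)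

lemma size_lift_ty [simp]: "size (lift_ty k T) = size T"
  by (induction T arbitrary: k) auto

lemma lift_lift_ty: "i \<le> k \<Longrightarrow> lift_ty i (lift_ty k T) = lift_ty (Suc k) (lift_ty i T)"
  by (induction T arbitrary: i k) auto

lemma subst_lift_ty [simp]: "subst_ty k G (lift_ty k T) = T"
  by (induction T arbitrary: k G) auto

lemma lift_subst_ty_le:
  "i \<le> k \<Longrightarrow> lift_ty i (subst_ty k G T) = subst_ty (Suc k) (lift_ty i G) (lift_ty i T)"
  by (induction T arbitrary: i k G) (auto simp: lift_lift_ty)

lemma lift_subst_ty_ge:
  "k \<le> i \<Longrightarrow> lift_ty i (subst_ty k G T) = subst_ty k (lift_ty i G) (lift_ty (Suc i) T)"
  by (induction T arbitrary: i k G) (auto simp: lift_lift_ty)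

lemma subst_subst_ty:
  "j \<le> k \<Longrightarrow> subst_ty k G (subst_ty j H T) =
     subst_ty j (subst_ty k G H) (subst_ty (Suc k) (lift_ty j G) T)"
  by (induction T arbitrary: j k G H) (auto simp: lift_subst_ty_le lift_lift_ty)

lemma subst_ty_TVar_lift_ty [simp]: "subst_ty k (TVar k) (lift_ty (Suc k) T) = T"
  by (induction T arbitrary: k) auto

lemma subst_ty_notfree: "\<not> free_ty k T \<Longrightarrow> subst_ty k G T = subst_ty k H T"
  by (induction T arbitrary: k G H) auto

text \<open>A hole strictly below the root makes \<open>G\<close> a proper part of the instance.
  This serves as an occurs check: a type with such a hole cannot have \<open>G\<close> itself as its
  instance at \<open>G\<close>.\<close>

lemma size_subst_ty_free: "free_ty k T \<Longrightarrow> T \<noteq> TVar k \<Longrightarrow> size (subst_ty k G T) > size G"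
proof (induction T arbitrary: k G)
  case (Fun A B)
  have "size (subst_ty k G A) \<ge> size G" if "free_ty k A"
    using Fun.IH(1)[OF that, of G] by (cases "A = TVar k") auto
  moreover have "size (subst_ty k G B) \<ge> size G" if "free_ty k B"
    using Fun.IH(2)[OF that, of G] by (cases "B = TVar k") auto
  ultimately show ?case using Fun.prems by auto
next
  case (All T)
  then show ?case using All.IH[of "Suc k" "lift_ty 0 G"] by (cases "T = TVar (Suc k)") auto
qed auto

text \<open>Read contrapositively, this keeps a hypothesis outside \<open>forall_neg\<close> when
  \<open>nf_gen\<close> lifts the context. The equation \<open>T = lift_ty k T'\<close> leaves
  \<open>T\<close> a variable for the rule induction.\<close>

lemma lift_ty_pos_neg:
  "T \<in> forall_pos \<Longrightarrow> T = lift_ty k T' \<Longrightarrow> T' \<in> forall_pos"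
  "T \<in> forall_neg \<Longrightarrow> T = lift_ty k T' \<Longrightarrow> T' \<in> forall_neg"
proof (induction arbitrary: k T' and k T' rule: forall_pos_forall_neg.inducts)
  case (pos_var i) then show ?case
    by (cases T') (auto intro: forall_pos_forall_neg.intros split: if_splits)
next
  case (neg_var i) then show ?case
    by (cases T') (auto intro: forall_pos_forall_neg.intros split: if_splits)
next
  case (pos_fun A B) then show ?case
    by (cases T') (auto intro: forall_pos_forall_neg.intros split: if_splits)
next
  case (neg_fun A B) then show ?case
    by (cases T') (auto intro: forall_pos_forall_neg.intros split: if_splits)
next
  case (pos_all A) then show ?case
    by (cases T') (auto intro: forall_pos_forall_neg.intros simp: free_ty_lift_ty split: if_splits)
qed

section \<open>Terms\<close>

lemma free_tm_lift_tm:
  "free_tm j (lift_tm k t) \<longleftrightarrow> (if j < k then free_tm j t else j \<noteq> k \<and> free_tm (j - 1) t)"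
proof (induction t arbitrary: j k)
  case (Lam t)
  then show ?case by (cases j) auto
qed auto

lemma lambdaI_simps [simp]:
  "lambdaI (Var i)"
  "lambdaI (App u v) \<longleftrightarrow> lambdaI u \<and> lambdaI v"
  "lambdaI (Lam u) \<longleftrightarrow> lambdaI u \<and> free_tm 0 u"
  by (auto intro: lambdaI.intros elim: lambdaI.cases)

lemma lambdaI_lift_tm [simp]: "lambdaI (lift_tm k t) \<longleftrightarrow> lambdaI t"
  by (induction t arbitrary: k) (auto simp: free_tm_lift_tm)

lemma beta_normal_Var [simp]: "beta_normal (Var i)"
  by (auto simp: beta_normal_def elim: beta.cases)

lemma beta_normal_Lam [simp]: "beta_normal (Lam u) \<longleftrightarrow> beta_normal u"
  by (auto simp: beta_normal_def intro: beta.intros elim: beta.cases)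

lemma beta_normal_App [simp]:
  "beta_normal (App u v) \<longleftrightarrow> beta_normal u \<and> beta_normal v \<and> (\<nexists>w. u = Lam w)"
  by (auto simp: beta_normal_def intro: beta.intros elim: beta.cases)

section \<open>Bidirectional typing of normal terms\<close>

text \<open>Neutral terms eliminate hypotheses, normal terms introduce. With no passage from
  \<open>nf_typing\<close> back to \<open>ne_typing\<close>, neither a beta-redex nor a
  generalization followed by an instantiation can occur. As \<open>nf_ne\<close> is allowed at every
  type, terms need not be eta-long.\<close>

inductive ne_typing :: "ty list \<Rightarrow> tm \<Rightarrow> ty \<Rightarrow> bool"
  and nf_typing :: "ty list \<Rightarrow> tm \<Rightarrow> ty \<Rightarrow> bool" where
  ne_var: "\<forall>A \<in> set \<Gamma>. proper A \<Longrightarrow> i < length \<Gamma> \<Longrightarrow> ne_typing \<Gamma> (Var i) (\<Gamma> ! i)"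
| ne_app: "ne_typing \<Gamma> n (Fun A B) \<Longrightarrow> nf_typing \<Gamma> s A \<Longrightarrow> ne_typing \<Gamma> (App n s) B"
| ne_inst: "ne_typing \<Gamma> n (All A) \<Longrightarrow> proper H \<Longrightarrow> ne_typing \<Gamma> n (subst_ty 0 H A)"
| nf_ne: "ne_typing \<Gamma> n T \<Longrightarrow> nf_typing \<Gamma> n T"
| nf_lam: "nf_typing (A # \<Gamma>) u B \<Longrightarrow> nf_typing \<Gamma> (Lam u) (Fun A B)"
| nf_gen: "nf_typing (map (lift_ty 0) \<Gamma>) u A \<Longrightarrow> proper (All A) \<Longrightarrow> nf_typing \<Gamma> u (All A)"

lemma ne_nf_proper:
  "ne_typing \<Gamma> n T \<Longrightarrow> proper T \<and> (\<forall>A \<in> set \<Gamma>. proper A)"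
  "nf_typing \<Gamma> t T \<Longrightarrow> proper T \<and> (\<forall>A \<in> set \<Gamma>. proper A)"
  by (induction rule: ne_typing_nf_typing.inducts) (auto intro: proper_subst_ty)

lemma ne_nf_typing:
  "ne_typing \<Gamma> n T \<Longrightarrow> typing \<Gamma> n T"
  "nf_typing \<Gamma> t T \<Longrightarrow> typing \<Gamma> t T"
  by (induction rule: ne_typing_nf_typing.inducts) (auto intro: typing.intros)

lemma ne_nf_beta_normal:
  "ne_typing \<Gamma> n T \<Longrightarrow> beta_normal n \<and> (\<nexists>u. n = Lam u)"
  "nf_typing \<Gamma> t T \<Longrightarrow> beta_normal t"
  by (induction rule: ne_typing_nf_typing.inducts) auto

lemma ne_nf_free_tm:
  "ne_typing \<Gamma> n T \<Longrightarrow> free_tm i n \<Longrightarrow> i < length \<Gamma>"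
  "nf_typing \<Gamma> t T \<Longrightarrow> free_tm i t \<Longrightarrow> i < length \<Gamma>"
  by (induction arbitrary: i and i rule: ne_typing_nf_typing.inducts) fastforce+

section \<open>Stability of normal derivations under substitution, lifting and weakening\<close>

lemma ne_nf_subst_ty:
  "ne_typing \<Gamma> n T \<Longrightarrow> proper G \<Longrightarrow> ne_typing (map (subst_ty k G) \<Gamma>) n (subst_ty k G T)"
  "nf_typing \<Gamma> t T \<Longrightarrow> proper G \<Longrightarrow> nf_typing (map (subst_ty k G) \<Gamma>) t (subst_ty k G T)"
proof (induction arbitrary: k G and k G rule: ne_typing_nf_typing.inducts)
  case (ne_var \<Gamma> i)
  then show ?case
    using ne_typing_nf_typing.ne_var[of "map (subst_ty k G) \<Gamma>" i] by (auto intro: proper_subst_ty)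
next
  case (ne_app \<Gamma> n A B s)
  show ?case
    using ne_app.IH[OF ne_app.prems, of k] by (auto intro: ne_typing_nf_typing.ne_app)
next
  case (ne_inst \<Gamma> n A H)
  then show ?case
    using ne_typing_nf_typing.ne_inst[OF ne_inst.IH[of G k, simplified], of "subst_ty k G H"]
    by (auto simp: subst_subst_ty proper_subst_ty)
next
  case (nf_gen \<Gamma> u A)
  then have "nf_typing (map (subst_ty (Suc k) (lift_ty 0 G)) (map (lift_ty 0) \<Gamma>)) u
    (subst_ty (Suc k) (lift_ty 0 G) A)" by simp
  then show ?case using nf_gen
    by (auto intro!: ne_typing_nf_typing.nf_gen proper_subst_ty
        simp: lift_subst_ty_le comp_def free_ty_subst_ty_less)
qed (auto intro: ne_typing_nf_typing.intros)

lemma ne_nf_lift_ty: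
  "ne_typing \<Gamma> n T \<Longrightarrow> ne_typing (map (lift_ty k) \<Gamma>) n (lift_ty k T)"
  "nf_typing \<Gamma> t T \<Longrightarrow> nf_typing (map (lift_ty k) \<Gamma>) t (lift_ty k T)"
proof (induction arbitrary: k and k rule: ne_typing_nf_typing.inducts)
  case (ne_var \<Gamma> i)
  then show ?case
    using ne_typing_nf_typing.ne_var[of "map (lift_ty k) \<Gamma>" i] by auto
next
  case (ne_app \<Gamma> n A B s)
  then show ?case by (auto intro: ne_typing_nf_typing.ne_app)
next
  case (ne_inst \<Gamma> n A H)
  then show ?case
    using ne_typing_nf_typing.ne_inst[OF ne_inst.IH[of k, simplified], of "lift_ty k H"]
    by (auto simp: lift_subst_ty_ge)
next
  case (nf_gen \<Gamma> u A)
  then have "nf_typing (map (lift_ty (Suc k)) (map (lift_ty 0) \<Gamma>)) u (lift_ty (Suc k) A)" by simp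
  then show ?case using nf_gen
    by (auto intro!: ne_typing_nf_typing.nf_gen simp: lift_lift_ty comp_def free_ty_lift_ty)
qed (auto intro: ne_typing_nf_typing.intros)

lemma ne_nf_weaken:
  "ne_typing \<Gamma> n T \<Longrightarrow> \<Gamma> = \<Gamma>1 @ \<Gamma>2 \<Longrightarrow> proper C \<Longrightarrow>
     ne_typing (\<Gamma>1 @ C # \<Gamma>2) (lift_tm (length \<Gamma>1) n) T"
  "nf_typing \<Gamma> t T \<Longrightarrow> \<Gamma> = \<Gamma>1 @ \<Gamma>2 \<Longrightarrow> proper C \<Longrightarrow>
     nf_typing (\<Gamma>1 @ C # \<Gamma>2) (lift_tm (length \<Gamma>1) t) T"
proof (induction arbitrary: \<Gamma>1 \<Gamma>2 C and \<Gamma>1 \<Gamma>2 C rule: ne_typing_nf_typing.inducts)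
  case (ne_var \<Gamma> i)
  show ?case
  proof (cases "i < length \<Gamma>1")
    case True
    then show ?thesis using ne_var ne_typing_nf_typing.ne_var[of "\<Gamma>1 @ C # \<Gamma>2" i]
      by (auto simp: nth_append)
  next
    case False
    then show ?thesis using ne_var ne_typing_nf_typing.ne_var[of "\<Gamma>1 @ C # \<Gamma>2" "Suc i"]
      by (auto simp: nth_append Suc_diff_le)
  qed
next
  case (ne_app \<Gamma> n A B s)
  show ?case
    using ne_app.IH[OF ne_app.prems] by (auto intro: ne_typing_nf_typing.ne_app)
next
  case (nf_lam A \<Gamma> u B)
  then show ?case using nf_lam.IH[of "A # \<Gamma>1" \<Gamma>2 C] by (auto intro: ne_typing_nf_typing.nf_lam)
next
  case (nf_gen \<Gamma> u A)
  then show ?case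
    using nf_gen.IH[of "map (lift_ty 0) \<Gamma>1" "map (lift_ty 0) \<Gamma>2" "lift_ty 0 C"]
    by (auto intro: ne_typing_nf_typing.nf_gen)
qed (auto intro: ne_typing_nf_typing.intros)

lemma ne_weaken: "ne_typing \<Gamma> n T \<Longrightarrow> proper C \<Longrightarrow> ne_typing (C # \<Gamma>) (lift_tm 0 n) T"
  using ne_nf_weaken(1)[of \<Gamma> n T "[]" \<Gamma> C] by simp

lemma nf_weaken: "nf_typing \<Gamma> t T \<Longrightarrow> proper C \<Longrightarrow> nf_typing (C # \<Gamma>) (lift_tm 0 t) T"
  using ne_nf_weaken(2)[of \<Gamma> t T "[]" \<Gamma> C] by simp

section \<open>Inversion, and completeness for beta-normal terms\<close>

lemma ne_inst_fresh:
  assumes "ne_typing \<Gamma> n (All A)"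
  shows "ne_typing (map (lift_ty 0) \<Gamma>) n A"
  using ne_inst[of _ n "lift_ty (Suc 0) A" "TVar 0"] ne_nf_lift_ty(1)[OF assms, of 0] by simp

lemma ne_var_0: "\<forall>A \<in> set \<Gamma>. proper A \<Longrightarrow> proper A \<Longrightarrow> ne_typing (A # \<Gamma>) (Var 0) A"
  using ne_var[of "A # \<Gamma>" 0] by simp

lemma nf_FunD:
  "nf_typing \<Gamma> t (Fun A B) \<Longrightarrow>
    ne_typing \<Gamma> t (Fun A B) \<or> (\<exists>u. t = Lam u \<and> nf_typing (A # \<Gamma>) u B)"
  by (auto elim: nf_typing.cases)

lemma nf_AllD: "nf_typing \<Gamma> t (All A) \<Longrightarrow> nf_typing (map (lift_ty 0) \<Gamma>) t A"
  by (erule nf_typing.cases) (auto intro: ne_inst_fresh nf_ne)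

text \<open>In Curry style a generalization followed by an instantiation leaves no trace in the
  term, so such a detour is removed by substituting in the types alone. In an application,
  beta-normality excludes an abstraction as function part, which is therefore neutral.\<close>

lemma typing_beta_normal_nf: "typing \<Gamma> t T \<Longrightarrow> beta_normal t \<Longrightarrow> nf_typing \<Gamma> t T"
proof (induction rule: typing.induct)
  case (arrE \<Gamma> u A B v)
  then show ?case using nf_FunD[of \<Gamma> u A B] by (auto intro: nf_ne ne_app)
next
  case (allE \<Gamma> t A G)
  then have "nf_typing (map (lift_ty 0) \<Gamma>) t A" by (auto intro: nf_AllD)
  from ne_nf_subst_ty(2)[OF this \<open>proper G\<close>, of 0] show ?case by (simp add: comp_def)
qed (auto intro: ne_typing_nf_typing.intros)

section \<open>Coercions between instances at \<open>G\<close> and at \<open>Fun K G\<close>\<close>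

text \<open>\<open>K_ty\<close> is closed, so lifting and substitution commute with padding. The
  inner abstraction of \<open>K_tm\<close> is vacuous, so an application to it is never a
  \<open>lambdaI\<close> term.\<close>

abbreviation K_ty :: ty where
  "K_ty \<equiv> All (Fun (TVar 0) (Fun (TVar 0) (TVar 0)))"

abbreviation K_tm :: tm where
  "K_tm \<equiv> Lam (Lam (Var (Suc 0)))"

abbreviation padded :: "ty \<Rightarrow> ty" where
  "padded G \<equiv> Fun K_ty G"

lemma nf_K_tm: "\<forall>A \<in> set \<Gamma>. proper A \<Longrightarrow> nf_typing \<Gamma> K_tm K_ty"
  using ne_var[of "TVar 0 # TVar 0 # map (lift_ty 0) \<Gamma>" "Suc 0"]
  by (auto intro!: nf_gen nf_lam intro: nf_ne)

lemma ne_unpad: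
  "ne_typing \<Gamma> n (padded G) \<Longrightarrow> ne_typing \<Gamma> (App n K_tm) G"
  using ne_nf_proper(1) nf_K_tm by (blast intro: ne_app)

lemma nf_pad:
  "nf_typing \<Gamma> t G \<Longrightarrow> nf_typing \<Gamma> (Lam (lift_tm 0 t)) (padded G)"
  by (auto intro!: nf_lam nf_weaken)

lemma not_lambdaI_pad: "\<not> lambdaI (Lam (lift_tm 0 t))"
  by (simp add: free_tm_lift_tm)

text \<open>
  A type with a hole is a type \<open>R\<close> with a distinguished variable \<open>k\<close>.  The types \<open>R\<close> and \<open>E\<close> below may
  differ, because \<open>G\<close> can occur in the common instance outside the holes: the holes of \<open>R\<close> come from
  the hypotheses and those of \<open>E\<close> are demanded by the context.
\<close>

lemma coerce_ne:
  assumes "ne_typing \<Gamma> n (subst_ty k (padded G) R)" "subst_ty k G R = subst_ty k G E"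
    and "proper R" "proper E" "proper G"
  shows "\<exists>t. nf_typing \<Gamma> t (subst_ty k (padded G) E) \<and>
    (free_ty k R \<or> free_ty k E \<or> \<not> lambdaI n \<longrightarrow> \<not> lambdaI t)"
  using assms
\<comment> \<open>The measure is symmetric because \<open>R\<close> and \<open>E\<close> exchange
  roles at the domain of an arrow.\<close>
proof (induction "size R + size E" arbitrary: R E \<Gamma> n k G rule: less_induct)
  case less
  note ne = less.prems(1) and eq = less.prems(2) and propers = less.prems(3-5)
  consider (holes) "R = TVar k" "E = TVar k" | (hole_l) "R = TVar k" "E \<noteq> TVar k"
    | (hole_r) "R \<noteq> TVar k" "E = TVar k" | (rigid) "R \<noteq> TVar k" "E \<noteq> TVar k" by blast
  then show ?case
  proof cases
    case holes
    then show ?thesis using ne nf_pad[OF nf_ne[OF ne_unpad]] not_lambdaI_pad by force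
  next
    case hole_l
    \<comment> \<open>\<open>G\<close> would otherwise be a proper part of itself\<close>
    then have E: "\<not> free_ty k E" using size_subst_ty_free[of k E G] eq by auto
    have "nf_typing \<Gamma> (App n K_tm) (subst_ty k G E)"
      using ne hole_l eq by (auto intro: nf_ne ne_unpad)
    then show ?thesis
      using subst_ty_notfree[OF E, of G "padded G"] by (intro exI[of _ "App n K_tm"]) simp
  next
    case hole_r
    then have R: "\<not> free_ty k R" using size_subst_ty_free[of k R G] eq by auto
    have "nf_typing \<Gamma> n G"
      using ne hole_r eq subst_ty_notfree[OF R, of G] by (auto intro: nf_ne)
    from nf_pad[OF this] show ?thesis using hole_r not_lambdaI_pad by force
  next
    case rigid
    show ?thesis
    proof (cases R)
      case (TVar j)
      then have "E = TVar j" using eq rigid by (cases E) (auto split: if_splits)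
      then show ?thesis using ne TVar rigid by (intro exI[of _ n]) (auto intro: nf_ne)
    next
      case (Fun R1 R2)
      then obtain E1 E2 where E: "E = Fun E1 E2" and eq1: "subst_ty k G E1 = subst_ty k G R1"
        and eq2: "subst_ty k G R2 = subst_ty k G E2"
        using eq rigid by (cases E) (auto split: if_splits)
      let ?A = "subst_ty k (padded G) E1"
      have A: "proper ?A" using propers E by (auto intro!: proper_subst_ty)
      have "ne_typing (?A # \<Gamma>) (Var 0) ?A"
        using A ne_nf_proper(1)[OF ne] by (auto intro: ne_var_0)
      \<comment> \<open>The fresh argument has the domain type demanded by \<open>E\<close>; it is
        coerced contravariantly to the domain that \<open>n\<close> expects.\<close>
      then obtain w where w: "nf_typing (?A # \<Gamma>) w (subst_ty k (padded G) R1)"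
        "free_ty k R1 \<or> free_ty k E1 \<longrightarrow> \<not> lambdaI w"
        using less.hyps[OF _ _ eq1] propers E Fun by fastforce
      have "ne_typing (?A # \<Gamma>) (App (lift_tm 0 n) w) (subst_ty k (padded G) R2)"
        using ne_weaken[OF ne A] w Fun by (auto intro: ne_app)
      \<comment> \<open>If the domains have a hole, \<open>w\<close> and hence the application is no
        \<open>lambdaI\<close> term; the disjunct \<open>\<not> lambdaI n\<close> of the statement
        carries this over to \<open>t\<close>.\<close>
      then obtain t where t: "nf_typing (?A # \<Gamma>) t (subst_ty k (padded G) E2)"
        "free_ty k R2 \<or> free_ty k E2 \<or> \<not> lambdaI (App (lift_tm 0 n) w) \<longrightarrow> \<not> lambdaI t"
        using less.hyps[OF _ _ eq2] propers E Fun by fastforce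
      show ?thesis
        using t w E Fun by (intro exI[of _ "Lam t"]) (auto intro: nf_lam)
    next
      case (All R1)
      then obtain E1 where E: "E = All E1"
        and eq1: "subst_ty (Suc k) (lift_ty 0 G) R1 = subst_ty (Suc k) (lift_ty 0 G) E1"
        using eq rigid by (cases E) (auto split: if_splits)
      have "ne_typing (map (lift_ty 0) \<Gamma>) n (subst_ty (Suc k) (padded (lift_ty 0 G)) R1)"
        using ne_inst_fresh[of \<Gamma> n] ne All by auto
      then obtain t where "nf_typing (map (lift_ty 0) \<Gamma>) t (subst_ty (Suc k) (padded (lift_ty 0 G)) E1)"
        "free_ty (Suc k) R1 \<or> free_ty (Suc k) E1 \<or> \<not> lambdaI n \<longrightarrow> \<not> lambdaI t"
        using less.hyps[OF _ _ eq1] propers E All by fastforce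
      then show ?thesis
        using E All propers ne_nf_proper(2)
        by (intro exI[of _ t]) (auto intro!: nf_gen simp: free_ty_subst_ty_less)
    qed
  qed
qed

text \<open>A neutral term synthesizes its type with holes \<open>R\<close> from the hypotheses, a
  normal term is checked against a given \<open>E\<close>; \<open>coerce_ne\<close> reconciles the
  two at \<open>nf_ne\<close>. A \<open>lambdaI\<close> term uses every variable it binds, so a hole
  in a used hypothesis leads to a repair or survives in \<open>R\<close>.\<close>

lemma coerce_ne_nf:
  "ne_typing \<Gamma> n T \<Longrightarrow> \<Gamma> = map (subst_ty k G) \<Delta> \<Longrightarrow> \<forall>A \<in> set \<Delta>. proper A \<Longrightarrow> proper G \<Longrightarrow>
     lambdaI n \<Longrightarrow>
     \<exists>R n'. proper R \<and> T = subst_ty k G R \<and>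
       ne_typing (map (subst_ty k (padded G)) \<Delta>) n' (subst_ty k (padded G) R) \<and>
       (lambdaI n' \<and> \<not> free_ty k R \<longrightarrow> (\<forall>i. free_tm i n \<longrightarrow> \<not> free_ty k (\<Delta> ! i)))"
  "nf_typing \<Gamma> t T \<Longrightarrow> \<Gamma> = map (subst_ty k G) \<Delta> \<Longrightarrow> \<forall>A \<in> set \<Delta>. proper A \<Longrightarrow> proper G \<Longrightarrow>
     lambdaI t \<Longrightarrow> T = subst_ty k G E \<Longrightarrow> proper E \<Longrightarrow>
     \<exists>t'. nf_typing (map (subst_ty k (padded G)) \<Delta>) t' (subst_ty k (padded G) E) \<and>
       (lambdaI t' \<longrightarrow> \<not> free_ty k E \<and> (\<forall>i. free_tm i t \<longrightarrow> \<not> free_ty k (\<Delta> ! i)))"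
proof (induction arbitrary: k G \<Delta> and k G \<Delta> E rule: ne_typing_nf_typing.inducts)
  case (ne_var \<Gamma> i)
  have "ne_typing (map (subst_ty k (padded G)) \<Delta>) (Var i) (subst_ty k (padded G) (\<Delta> ! i))"
    using ne_var ne_typing_nf_typing.ne_var[of "map (subst_ty k (padded G)) \<Delta>" i]
    by (simp add: proper_subst_ty free_ty_subst_ty_less)
  then show ?case using ne_var by (intro exI[of _ "\<Delta> ! i"]) auto
next
  case (ne_app \<Gamma> n A B s)
  let ?\<Delta>' = "map (subst_ty k (padded G)) \<Delta>"
  obtain R n' where R: "proper R" "Fun A B = subst_ty k G R"
    and n': "ne_typing ?\<Delta>' n' (subst_ty k (padded G) R)"
      "lambdaI n' \<and> \<not> free_ty k R \<longrightarrow> (\<forall>i. free_tm i n \<longrightarrow> \<not> free_ty k (\<Delta> ! i))"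
    using ne_app.IH(1)[of k G \<Delta>] ne_app.prems by auto
  note IH_s = ne_app.IH(2)[of k G \<Delta>]
  show ?case
  proof (cases "R = TVar k")
    case True
    \<comment> \<open>The hole is the whole function type, so \<open>n'\<close> is unpadded before
      it is applied. Argument and result types are lifted to be free of holes, and the presence of
      \<open>K_tm\<close> makes the \<open>lambdaI\<close> clause vacuous.\<close>
    then have G: "G = Fun A B" using R by simp
    then have fn: "ne_typing ?\<Delta>' (App n' K_tm) (Fun A B)"
      using n' True by (auto intro: ne_unpad)
    obtain s' where "nf_typing ?\<Delta>' s' A"
      using IH_s[of "lift_ty k A"] ne_app.prems G by auto
    then have "ne_typing ?\<Delta>' (App (App n' K_tm) s') B"
      using fn by (rule ne_typing_nf_typing.ne_app[rotated])
    then show ?thesis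
      using ne_app.prems G
      by (intro exI[of _ "lift_ty k B"] exI[of _ "App (App n' K_tm) s'"]) simp
  next
    case False
    then obtain R1 R2 where R12: "R = Fun R1 R2" "A = subst_ty k G R1" "B = subst_ty k G R2"
      using R by (cases R) (auto split: if_splits)
    obtain s' where s': "nf_typing ?\<Delta>' s' (subst_ty k (padded G) R1)"
      "lambdaI s' \<longrightarrow> \<not> free_ty k R1 \<and> (\<forall>i. free_tm i s \<longrightarrow> \<not> free_ty k (\<Delta> ! i))"
      using IH_s[of R1] ne_app.prems R R12 by auto
    then have "ne_typing ?\<Delta>' (App n' s') (subst_ty k (padded G) R2)"
      using n' R12 by (auto intro: ne_typing_nf_typing.ne_app)
    then show ?thesis
      using R R12 n' s' by (intro exI[of _ R2] exI[of _ "App n' s'"]) auto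
  qed
next
  case (ne_inst \<Gamma> n A H)
  let ?\<Delta>' = "map (subst_ty k (padded G)) \<Delta>"
  obtain R n' where R: "proper R" "All A = subst_ty k G R"
    and n': "ne_typing ?\<Delta>' n' (subst_ty k (padded G) R)"
      "lambdaI n' \<and> \<not> free_ty k R \<longrightarrow> (\<forall>i. free_tm i n \<longrightarrow> \<not> free_ty k (\<Delta> ! i))"
    using ne_inst.IH[of k G \<Delta>] ne_inst.prems by auto
  show ?case
  proof (cases "R = TVar k")
    case True
    then have G: "G = All A" using R by simp
    then have "ne_typing ?\<Delta>' (App n' K_tm) (subst_ty 0 H A)"
      using n' True ne_inst.hyps by (auto intro: ne_unpad ne_typing_nf_typing.ne_inst)
    then show ?thesis
      using ne_inst.prems ne_inst.hyps G
      by (intro exI[of _ "lift_ty k (subst_ty 0 H A)"] exI[of _ "App n' K_tm"])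
        (auto intro: proper_subst_ty)
  next
    case False
    then obtain R1 where R1: "R = All R1" "A = subst_ty (Suc k) (lift_ty 0 G) R1"
      using R by (cases R) (auto split: if_splits)
    \<comment> \<open>Lifting \<open>H\<close> keeps its variables apart from the hole, so
      instantiating the quantifier commutes with filling the hole.\<close>
    let ?S = "subst_ty 0 (lift_ty k H) R1"
    have inst: "subst_ty k F ?S = subst_ty 0 H (subst_ty (Suc k) (lift_ty 0 F) R1)" for F
      by (simp add: subst_subst_ty)
    have "ne_typing ?\<Delta>' n' (subst_ty k (padded G) ?S)"
      unfolding inst using n' R1 ne_inst.hyps by (auto intro: ne_typing_nf_typing.ne_inst)
    moreover have "free_ty k ?S" if "free_ty k R"
      using that R1 by (simp add: free_ty_subst_ty_ge)
    ultimately show ?thesis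
      using R R1 n' ne_inst.hyps inst[of G]
      by (intro exI[of _ ?S] exI[of _ n']) (auto intro: proper_subst_ty)
  qed
next
  case (nf_ne \<Gamma> n T)
  let ?\<Delta>' = "map (subst_ty k (padded G)) \<Delta>"
  obtain R n' where R: "proper R" "T = subst_ty k G R"
    and n': "ne_typing ?\<Delta>' n' (subst_ty k (padded G) R)"
      "lambdaI n' \<and> \<not> free_ty k R \<longrightarrow> (\<forall>i. free_tm i n \<longrightarrow> \<not> free_ty k (\<Delta> ! i))"
    using nf_ne.IH[of k G \<Delta>] nf_ne.prems by auto
  have "subst_ty k G R = subst_ty k G E" using nf_ne.prems R by simp
  from coerce_ne[OF n'(1) this] obtain t' where
    "nf_typing ?\<Delta>' t' (subst_ty k (padded G) E)"
    "free_ty k R \<or> free_ty k E \<or> \<not> lambdaI n' \<longrightarrow> \<not> lambdaI t'"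
    using R nf_ne.prems by blast
  then show ?case using n'(2) by blast
next
  case (nf_lam A \<Gamma> u B)
  let ?\<Delta>' = "map (subst_ty k (padded G)) \<Delta>"
  have arrow: "\<exists>t'. nf_typing ?\<Delta>' t' (subst_ty k (padded G) (Fun E1 E2)) \<and>
    (lambdaI t' \<longrightarrow> \<not> free_ty k (Fun E1 E2) \<and> (\<forall>i. free_tm i (Lam u) \<longrightarrow> \<not> free_ty k (\<Delta> ! i)))"
    if E12: "A = subst_ty k G E1" "B = subst_ty k G E2" "proper E1" "proper E2" for E1 E2
  proof -
    obtain u' where "nf_typing (map (subst_ty k (padded G)) (E1 # \<Delta>)) u' (subst_ty k (padded G) E2)"
      and u': "lambdaI u' \<longrightarrow> \<not> free_ty k E2 \<and> (\<forall>i. free_tm i u \<longrightarrow> \<not> free_ty k ((E1 # \<Delta>) ! i))"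
      using nf_lam.IH[of k G "E1 # \<Delta>" E2] nf_lam.prems E12 by auto
    then have "nf_typing ?\<Delta>' (Lam u') (subst_ty k (padded G) (Fun E1 E2))"
      by (auto intro: ne_typing_nf_typing.nf_lam)
    \<comment> \<open>The bound variable occurs, so a hole in its type \<open>E1\<close> counts as a
      hole in a used hypothesis of \<open>u\<close>.\<close>
    moreover have "free_tm 0 u" using nf_lam.prems by simp
    ultimately show ?thesis using u' by (intro exI[of _ "Lam u'"]) force
  qed
  show ?case
  proof (cases "E = TVar k")
    case True
    then have G: "G = Fun A B" using nf_lam.prems by simp
    then have "proper A" "proper B" using nf_lam.prems(3) by simp_all
    then obtain t' where "nf_typing ?\<Delta>' t' G"
      using arrow[of "lift_ty k A" "lift_ty k B"] unfolding G by auto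
    from nf_pad[OF this] show ?thesis using True not_lambdaI_pad by force
  next
    case False
    then obtain E1 E2 where "E = Fun E1 E2" "A = subst_ty k G E1" "B = subst_ty k G E2"
      using nf_lam.prems by (cases E) (auto split: if_splits)
    then show ?thesis using arrow[of E1 E2] nf_lam.prems by simp
  qed
next
  case (nf_gen \<Gamma> u A)
  let ?\<Delta>' = "map (subst_ty k (padded G)) \<Delta>"
  have all: "\<exists>t'. nf_typing ?\<Delta>' t' (subst_ty k (padded G) (All E1)) \<and>
    (lambdaI t' \<longrightarrow> \<not> free_ty k (All E1) \<and> (\<forall>i. free_tm i u \<longrightarrow> \<not> free_ty k (\<Delta> ! i)))"
    if E1: "A = subst_ty (Suc k) (lift_ty 0 G) E1" "proper (All E1)" for E1
  proof -
    have ctx: "map (subst_ty (Suc k) (lift_ty 0 F)) (map (lift_ty 0) \<Delta>) =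
      map (lift_ty 0) (map (subst_ty k F) \<Delta>)" for F
      by (simp add: lift_subst_ty_le)
    obtain u' where u': "nf_typing (map (subst_ty (Suc k) (padded (lift_ty 0 G))) (map (lift_ty 0) \<Delta>)) u'
        (subst_ty (Suc k) (padded (lift_ty 0 G)) E1)"
      "lambdaI u' \<longrightarrow> \<not> free_ty (Suc k) E1 \<and>
        (\<forall>i. free_tm i u \<longrightarrow> \<not> free_ty (Suc k) (map (lift_ty 0) \<Delta> ! i))"
      using nf_gen.IH[of "Suc k" "lift_ty 0 G" "map (lift_ty 0) \<Delta>" E1] nf_gen.prems E1 ctx[of G]
      by auto
    then have "nf_typing (map (lift_ty 0) ?\<Delta>') u' (subst_ty (Suc k) (padded (lift_ty 0 G)) E1)"
      by (simp add: comp_def lift_subst_ty_le)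
    then have "nf_typing ?\<Delta>' u' (subst_ty k (padded G) (All E1))"
      using E1 ne_nf_proper(2)
      by (auto intro!: ne_typing_nf_typing.nf_gen simp: free_ty_subst_ty_less)
    moreover have "i < length \<Delta>" if "free_tm i u" for i
      using ne_nf_free_tm(2)[OF nf_gen.hyps(1) that] nf_gen.prems by simp
    ultimately show ?thesis
      using u'(2) by (intro exI[of _ u']) (auto simp: free_ty_lift_ty)
  qed
  show ?case
  proof (cases "E = TVar k")
    case True
    then have G: "G = All A" using nf_gen.prems by simp
    then have "proper (All A)" using nf_gen.prems(3) by simp
    then obtain t' where "nf_typing ?\<Delta>' t' G"
      using all[of "lift_ty (Suc k) A"] unfolding G by (auto simp: free_ty_lift_ty)
    from nf_pad[OF this] show ?thesis using True not_lambdaI_pad by force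
  next
    case False
    then obtain E1 where "E = All E1" "A = subst_ty (Suc k) (lift_ty 0 G) E1"
      using nf_gen.prems by (cases E) (auto split: if_splits)
    then show ?thesis using all[of E1] nf_gen.prems by simp
  qed
qed

section \<open>Escaping the lambda-I terms\<close>

lemma forall_pos_neg_simps [simp]:
  "TVar i \<in> forall_pos"
  "TVar i \<in> forall_neg"
  "Fun A B \<in> forall_pos \<longleftrightarrow> A \<in> forall_neg \<and> B \<in> forall_pos"
  "Fun A B \<in> forall_neg \<longleftrightarrow> A \<in> forall_pos \<and> B \<in> forall_neg"
  "All A \<in> forall_pos \<longleftrightarrow> A \<in> forall_pos \<and> free_ty 0 A"
  "All A \<notin> forall_neg"
  by (auto intro: forall_pos_forall_neg.intros elim: forall_pos.cases forall_neg.cases)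

text \<open>
  For a neutral term, either no quantifier of the type of its head variable has been instantiated
  yet, or there is a variant of the term whose type differs by padding the holes of some \<open>R\<close>; if \<open>R\<close>
  has no hole, the variant has the same type and has already left the \<open>lambdaI\<close> terms.
\<close>

lemma non_lambdaI_of_occurrence:
  assumes pos: "\<And>\<Gamma> t T. size T \<le> m \<Longrightarrow> T \<notin> forall_pos \<Longrightarrow> nf_typing \<Gamma> t T \<Longrightarrow>
      \<exists>t'. nf_typing \<Gamma> t' T \<and> \<not> lambdaI t'"
    and neg: "\<And>\<Gamma> n T. size T \<le> m \<Longrightarrow> T \<notin> forall_neg \<Longrightarrow> ne_typing \<Gamma> n T \<Longrightarrow>
      \<exists>t'. nf_typing \<Gamma> t' T \<and> \<not> lambdaI t'"
  shows "ne_typing \<Gamma> n T \<Longrightarrow> lambdaI n \<Longrightarrow> free_tm i n \<Longrightarrow> \<Gamma> ! i \<notin> forall_neg \<Longrightarrow>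
      size (\<Gamma> ! i) \<le> m \<Longrightarrow>
      size T \<le> m \<and> T \<notin> forall_neg \<or>
      (\<exists>R G n'. proper R \<and> proper G \<and> T = subst_ty 0 G R \<and>
        ne_typing \<Gamma> n' (subst_ty 0 (padded G) R) \<and> (free_ty 0 R \<or> \<not> lambdaI n'))"
    and "nf_typing \<Gamma> t T \<Longrightarrow> lambdaI t \<Longrightarrow> free_tm i t \<Longrightarrow> \<Gamma> ! i \<notin> forall_neg \<Longrightarrow>
      size (\<Gamma> ! i) \<le> m \<Longrightarrow> \<exists>t'. nf_typing \<Gamma> t' T \<and> \<not> lambdaI t'"
\<comment> \<open>\<open>pos\<close> and \<open>neg\<close> stand for the induction hypotheses of
  \<open>exists_non_lambdaI\<close> at types of size at most \<open>m\<close>.\<close>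
proof (induction arbitrary: i and i rule: ne_typing_nf_typing.inducts)
  case (ne_var \<Gamma> j)
  then show ?case by simp
next
  case (ne_app \<Gamma> n A B s)
  have B: "proper B" using ne_nf_proper(1)[OF ne_app.hyps(1)] by simp
  \<comment> \<open>An escaped variant of unchanged type fits the second disjunct:
    \<open>lift_ty 0 B\<close> has no hole, so any proper \<open>G\<close> will do, here
    \<open>TVar 0\<close>.\<close>
  have done_if: ?case if "ne_typing \<Gamma> n' B" "\<not> lambdaI n'" for n'
    using that B by (intro disjI2 exI[of _ "lift_ty 0 B"] exI[of _ "TVar 0"] exI[of _ n']) simp
  show ?case
  proof (cases "free_tm i n")
    case False
    then obtain s' where "nf_typing \<Gamma> s' A" "\<not> lambdaI s'"
      using ne_app.IH(2)[of i] ne_app.prems by auto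
    then show ?thesis
      using ne_typing_nf_typing.ne_app[OF ne_app.hyps(1)] by (intro done_if[of "App n s'"]) auto
  next
    case True
    then consider (arrow) "size (Fun A B) \<le> m" "Fun A B \<notin> forall_neg"
      | (hole) R G n' where "proper R" "proper G" "Fun A B = subst_ty 0 G R"
        "ne_typing \<Gamma> n' (subst_ty 0 (padded G) R)" "free_ty 0 R \<or> \<not> lambdaI n'"
      using ne_app.IH(1)[of i] ne_app.prems by auto
    then show ?thesis
    proof cases
      case arrow
      show ?thesis
      \<comment> \<open>As \<open>Fun A B\<close> is outside \<open>forall_neg\<close>, either
        \<open>B\<close> is too and nothing has been instantiated yet, or \<open>A\<close> is
        outside \<open>forall_pos\<close> and the argument can be exchanged for an escaped
        one.\<close>
      proof (cases "A \<in> forall_pos")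
        case True
        then show ?thesis using arrow by auto
      next
        case False
        then obtain s' where "nf_typing \<Gamma> s' A" "\<not> lambdaI s'"
          using pos[OF _ False ne_app.hyps(2)] arrow by auto
        then show ?thesis
          using ne_typing_nf_typing.ne_app[OF ne_app.hyps(1)]
          by (intro done_if[of "App n s'"]) auto
      qed
    next
      case hole
      show ?thesis
      proof (cases "R = TVar 0")
        case True
        then have "ne_typing \<Gamma> (App n' K_tm) (Fun A B)" using hole by (auto intro: ne_unpad)
        from ne_typing_nf_typing.ne_app[OF this ne_app.hyps(2)] show ?thesis
          by (rule done_if) simp
      next
        case False
        then obtain R1 R2 where R: "R = Fun R1 R2" "A = subst_ty 0 G R1" "B = subst_ty 0 G R2"
          using hole by (cases R) (auto split: if_splits)
        \<comment> \<open>The lifted context is free of holes, so passing from \<open>G\<close> to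
          \<open>padded G\<close> leaves it alone and changes only the type \<open>R1\<close> of the
          argument.\<close>
        have ctx: "map (subst_ty 0 F) (map (lift_ty 0) \<Gamma>) = \<Gamma>" for F
          by (simp add: comp_def)
        have "\<exists>s'. nf_typing (map (subst_ty 0 (padded G)) (map (lift_ty 0) \<Gamma>)) s'
            (subst_ty 0 (padded G) R1) \<and>
          (lambdaI s' \<longrightarrow> \<not> free_ty 0 R1 \<and>
            (\<forall>i. free_tm i s \<longrightarrow> \<not> free_ty 0 (map (lift_ty 0) \<Gamma> ! i)))"
          by (rule coerce_ne_nf(2)[OF ne_app.hyps(2)])
            (use ctx R hole ne_app.prems ne_nf_proper(1)[OF ne_app.hyps(1)] in auto)
        then obtain s' where s': "nf_typing \<Gamma> s' (subst_ty 0 (padded G) R1)"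
          "lambdaI s' \<longrightarrow> \<not> free_ty 0 R1"
          unfolding ctx by blast
        then have "ne_typing \<Gamma> (App n' s') (subst_ty 0 (padded G) R2)"
          using hole R by (auto intro: ne_typing_nf_typing.ne_app)
        then show ?thesis
          using s' hole R by (intro disjI2 exI[of _ R2] exI[of _ G] exI[of _ "App n' s'"]) auto
      qed
    qed
  qed
next
  case (ne_inst \<Gamma> n A H)
  then have "proper A" "free_ty 0 A" using ne_nf_proper(1) by fastforce+
  from ne_inst.IH[OF ne_inst.prems] consider "All A \<notin> forall_neg"
    | (hole) R G n' where "proper R" "proper G" "All A = subst_ty 0 G R"
      "ne_typing \<Gamma> n' (subst_ty 0 (padded G) R)" "free_ty 0 R \<or> \<not> lambdaI n'"
    by blast
  then show ?case
  proof cases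
    case 1
    \<comment> \<open>At this first instantiation \<open>H\<close> is replaced by
      \<open>padded H\<close>; the body \<open>A\<close> is itself the type with holes, and
      properness provides one.\<close>
    have "ne_typing \<Gamma> n (subst_ty 0 (padded H) A)"
      using ne_inst.hyps by (auto intro: ne_typing_nf_typing.ne_inst)
    then show ?thesis
      using \<open>proper A\<close> \<open>free_ty 0 A\<close> ne_inst.hyps
      by (intro disjI2 exI[of _ A] exI[of _ H] exI[of _ n]) simp
  next
    case hole
    show ?thesis
    proof (cases "R = TVar 0")
      case True
      then have "ne_typing \<Gamma> (App n' K_tm) (All A)" using hole by (auto intro: ne_unpad)
      from ne_typing_nf_typing.ne_inst[OF this \<open>proper H\<close>] show ?thesis
        using \<open>proper A\<close> \<open>proper H\<close>
        by (intro disjI2 exI[of _ "lift_ty 0 (subst_ty 0 H A)"] exI[of _ "TVar 0"]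
            exI[of _ "App n' K_tm"]) (simp add: proper_subst_ty)
    next
      case False
      then obtain R1 where R1: "R = All R1" "A = subst_ty (Suc 0) (lift_ty 0 G) R1"
        using hole by (cases R) (auto split: if_splits)
      let ?S = "subst_ty 0 (lift_ty 0 H) R1"
      have inst: "subst_ty 0 F ?S = subst_ty 0 H (subst_ty (Suc 0) (lift_ty 0 F) R1)" for F
        by (simp add: subst_subst_ty)
      have "ne_typing \<Gamma> n' (subst_ty 0 (padded G) ?S)"
        unfolding inst using hole R1 ne_inst.hyps by (auto intro: ne_typing_nf_typing.ne_inst)
      moreover have "free_ty 0 ?S" if "free_ty 0 R"
        using that R1 by (simp add: free_ty_subst_ty_ge)
      ultimately show ?thesis
        using hole R1 ne_inst.hyps inst[of G]
        by (intro disjI2 exI[of _ ?S] exI[of _ G] exI[of _ n']) (auto intro: proper_subst_ty)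
    qed
  qed
next
  case (nf_ne \<Gamma> n T)
  from nf_ne.IH[OF nf_ne.prems] consider "size T \<le> m" "T \<notin> forall_neg"
    | (hole) R G n' where "proper R" "proper G" "T = subst_ty 0 G R"
      "ne_typing \<Gamma> n' (subst_ty 0 (padded G) R)" "free_ty 0 R \<or> \<not> lambdaI n'"
    by blast
  then show ?case
  proof cases
    case 1
    then show ?thesis using neg nf_ne.hyps by blast
  next
    case hole
    then show ?thesis
      using coerce_ne[of \<Gamma> n' 0 G R "lift_ty 0 T"] ne_nf_proper(1)[OF nf_ne.hyps] by auto
  qed
next
  case (nf_lam A \<Gamma> u B)
  have "\<exists>u'. nf_typing (A # \<Gamma>) u' B \<and> \<not> lambdaI u'"
    using nf_lam.IH[of "Suc i"] nf_lam.prems by simp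
  then obtain u' where "nf_typing (A # \<Gamma>) u' B" "\<not> lambdaI u'"
    by blast
  then show ?case by (intro exI[of _ "Lam u'"]) (auto intro: ne_typing_nf_typing.nf_lam)
next
  case (nf_gen \<Gamma> u A)
  have "i < length \<Gamma>" using ne_nf_free_tm(2)[OF nf_gen.hyps(1) nf_gen.prems(2)] by simp
  then obtain u' where "nf_typing (map (lift_ty 0) \<Gamma>) u' A" "\<not> lambdaI u'"
    using nf_gen.IH[of i] nf_gen.prems lift_ty_pos_neg(2)[OF _ refl] by auto
  then show ?case using ne_typing_nf_typing.nf_gen[OF _ nf_gen.hyps(2)] by blast
qed

text \<open>Polarities are exchanged at the domain of an arrow. Outside \<open>forall_neg\<close>,
  an arrow is treated by eta-expanding \<open>n\<close>, a quantifier by instantiating it at a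
  padded fresh variable. Outside \<open>forall_pos\<close>, an abstraction whose domain is at fault
  has escaped already or uses its variable, and then \<open>non_lambdaI_of_occurrence\<close>
  applies.\<close>

lemma exists_non_lambdaI:
  "T \<notin> forall_pos \<Longrightarrow> nf_typing \<Gamma> t T \<Longrightarrow> \<exists>t'. nf_typing \<Gamma> t' T \<and> \<not> lambdaI t'"
  "T \<notin> forall_neg \<Longrightarrow> ne_typing \<Gamma> n T \<Longrightarrow> \<exists>t'. nf_typing \<Gamma> t' T \<and> \<not> lambdaI t'"
proof (induction T arbitrary: \<Gamma> t n rule: measure_induct_rule[of size])
  case (less T)
  note IH_pos = less.IH(1) and IH_neg = less.IH(2)
  {
    case 1
    show ?case
    proof (cases T)
      case (TVar i)
      then show ?thesis using 1 by simp
    next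
      case (Fun A B)
      then have "proper A" and \<Gamma>: "\<forall>A \<in> set \<Gamma>. proper A"
        using ne_nf_proper(2)[OF 1(2)] by auto
      have var: "ne_typing (A # \<Gamma>) (Var 0) A" using \<open>proper A\<close> \<Gamma> by (rule ne_var_0[rotated])
      have lam: "\<exists>u'. nf_typing (A # \<Gamma>) u' B \<and> (\<not> lambdaI u' \<or> \<not> free_tm 0 u')"
      proof (cases "B \<in> forall_pos")
        case False
        have "\<exists>u. nf_typing (A # \<Gamma>) u B"
          using 1(2) ne_app[OF ne_weaken nf_ne[OF var]] nf_FunD[of \<Gamma> t A B] \<open>proper A\<close> Fun
          by (blast intro: nf_ne)
        then show ?thesis using IH_pos[of B] False Fun by fastforce
      next
        case True
        then have A: "A \<notin> forall_neg" using 1(1) Fun by simp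
        from 1(2) Fun consider (ne) "ne_typing \<Gamma> t (Fun A B)"
          | (abs) u where "nf_typing (A # \<Gamma>) u B" using nf_FunD by blast
        then show ?thesis
        proof cases
          case ne
          obtain w where "nf_typing (A # \<Gamma>) w A" "\<not> lambdaI w"
            using IH_neg[OF _ A var] Fun by auto
          then show ?thesis
            using ne_app[OF ne_weaken[OF ne \<open>proper A\<close>]]
            by (intro exI[of _ "App (lift_tm 0 t) w"]) (auto intro: nf_ne)
        next
          case abs
          show ?thesis
          proof (cases "lambdaI u \<and> free_tm 0 u")
            case True
            have "\<exists>u'. nf_typing (A # \<Gamma>) u' B \<and> \<not> lambdaI u'"
            \<comment> \<open>The variable at fault is the abstracted one, of index 0; its type
              \<open>A\<close> is smaller than \<open>T\<close>, so the induction hypotheses cover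
              all types up to \<open>size A\<close>.\<close>
            proof (rule non_lambdaI_of_occurrence(2)[where m = "size A" and i = 0, OF _ _ abs])
              show "\<exists>t'. nf_typing \<Delta> t' S \<and> \<not> lambdaI t'"
                if "size S \<le> size A" "S \<notin> forall_pos" "nf_typing \<Delta> t S" for \<Delta> t S
                using IH_pos[OF _ that(2,3)] that(1) Fun by simp
              show "\<exists>t'. nf_typing \<Delta> t' S \<and> \<not> lambdaI t'"
                if "size S \<le> size A" "S \<notin> forall_neg" "ne_typing \<Delta> n S" for \<Delta> n S
                using IH_neg[OF _ that(2,3)] that(1) Fun by simp
            qed (use A True in simp_all)
            then show ?thesis by blast
          next
            case False
            then show ?thesis using abs by blast
          qed
        qed
      qed
      then show ?thesis using Fun by (metis lambdaI_simps(3) nf_lam)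
    next
      case (All A)
      then have A: "proper (All A)" using ne_nf_proper(2)[OF 1(2)] by simp
      then have "A \<notin> forall_pos" using 1(1) All by simp
      moreover have "nf_typing (map (lift_ty 0) \<Gamma>) t A" using 1(2) All nf_AllD by simp
      ultimately obtain t' where "nf_typing (map (lift_ty 0) \<Gamma>) t' A" "\<not> lambdaI t'"
        using IH_pos[of A] All by auto
      then show ?thesis using nf_gen A All by blast
    qed
  next
    case 2
    show ?case
    proof (cases T)
      case (TVar i)
      then show ?thesis using 2 by simp
    next
      case (Fun A B)
      then have "proper A" and \<Gamma>: "\<forall>A \<in> set \<Gamma>. proper A"
        using ne_nf_proper(1)[OF 2(2)] by auto
      have var: "ne_typing (A # \<Gamma>) (Var 0) A" using \<open>proper A\<close> \<Gamma> by (rule ne_var_0[rotated])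
      have app: "nf_typing (A # \<Gamma>) w A \<Longrightarrow> ne_typing (A # \<Gamma>) (App (lift_tm 0 n) w) B" for w
        using ne_app[OF ne_weaken] 2(2) Fun \<open>proper A\<close> by blast
      have "\<exists>u. nf_typing (A # \<Gamma>) u B \<and> \<not> lambdaI u"
      proof (cases "A \<in> forall_pos")
        case False
        then obtain w where w: "nf_typing (A # \<Gamma>) w A" "\<not> lambdaI w"
          using IH_pos[OF _ False nf_ne[OF var]] Fun by auto
        from nf_ne[OF app[OF w(1)]] show ?thesis
          using w(2) by (intro exI[of _ "App (lift_tm 0 n) w"]) simp
      next
        case True
        then show ?thesis using IH_neg[of B] 2(1) Fun app[OF nf_ne[OF var]] by auto
      qed
      then show ?thesis using Fun by (metis lambdaI_simps(3) nf_lam)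
    next
      case (All A)
      have A: "proper A" "free_ty 0 A" using ne_nf_proper(1)[OF 2(2)] All by simp_all
      let ?X = "TVar 0"
      have "ne_typing (map (lift_ty 0) \<Gamma>) n (All (lift_ty (Suc 0) A))"
        using ne_nf_lift_ty(1)[OF 2(2), of 0] All by simp
      then have "ne_typing (map (lift_ty 0) \<Gamma>) n (subst_ty 0 (padded ?X) (lift_ty (Suc 0) A))"
        by (rule ne_inst) simp
      \<comment> \<open>Source and target have the same instance \<open>A\<close> at
        \<open>?X\<close>. The source has a hole at each occurrence of the quantified variable, at
        least one by properness; the target \<open>lift_ty 0 A\<close> has none.\<close>
      from coerce_ne[OF this, of "lift_ty 0 A"] A
      obtain t where "nf_typing (map (lift_ty 0) \<Gamma>) t A" "\<not> lambdaI t"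
        by (auto simp: free_ty_lift_ty)
      then show ?thesis using A All nf_gen[of \<Gamma> t A] by (intro exI[of _ t]) simp
    qed
  }
qed

theorem mainTheorem1:
  fixes D :: ty
  assumes "proper D"
    and "provable D"
    and "I_type D"
  shows "D \<in> forall_pos"
proof (rule ccontr)
  assume "D \<notin> forall_pos"
  moreover obtain t where "typing [] t D" "beta_normal t"
    using assms by (auto simp: provable_def beta_eta_normal_def beta_normal_def)
  ultimately obtain t' where t': "nf_typing [] t' D" "\<not> lambdaI t'"
    using exists_non_lambdaI(1) typing_beta_normal_nf by blast
  then have "closed_tm t'" "beta_normal t'" "typing [] t' D"
    using ne_nf_free_tm(2)[OF t'(1)] ne_nf_beta_normal ne_nf_typing by (auto simp: closed_tm_def)
  with t' assms show False by (auto simp: I_type_def)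
qed

end
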